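(* Transitive tournaments and the tournaments $\Delta(1,1,k)$ ($k\ge 1$) are heroes in orientations of chordal graphs. More precisely, for every integer $k\geq 1$: every orientation of a chordal graph with no induced copy of $TT_k$ has dichromatic number at most $2^{k-1}-1$, and every orientation of a chordal graph with no induced copy of $\Delta(1,1,k)$ has dichromatic number at most $2^{2k-2}$.
   Context: All digraphs are finite and simple (no loops, no parallel arcs, no digons). An orientation of a chordal graph is a digraph whose underlying undirected graph has no induced cycle of length at least $4$. The dichromatic number $\vec{\chi}(G)$ of a digraph $G$ is the least $k$ such that $V(G)$ can be partitioned into $k$ sets each inducing an acyclic subdigraph. A digraph is $H$-free if it contains no induced copy of $H$; $H$ is a hero in a hereditary class $\mathcal{C}$ if $H$-free digraphs in $\mathcal{C}$ have bounded dichromatic number. $TT_k$ denotes the transitive (acyclic) tournament on $k$ vertices. $\Delta(1,1,k)$ is the tournament with vertices $x,y$ and a copy $T$ of $TT_k$, with arcs $x\to y$, $y\to t$ and $t\to x$ for all $t\in V(T)$ (plus the arcs inside $T$). *)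

theory Defs
  imports
    "Graph_Theory.Graph_Theory"
    "HOL-Library.Disjoint_Sets"
begin

locale oriented_digraph = digraph +
  assumes no_digons: "u \<rightarrow>\<^bsub>G\<^esub> v \<Longrightarrow> \<not> v \<rightarrow>\<^bsub>G\<^esub> u"

definition acyclic_digraph :: "('a,'b) pre_digraph \<Rightarrow> bool" where
  "acyclic_digraph G \<longleftrightarrow> (\<nexists>p. pre_digraph.cycle G p)"

text \<open>Parts are non-empty (as required by \<^const>\<open>partition_on\<close>); this does not affect the
  least \<open>k\<close>. The null digraph has dichromatic number 0.\<close>

definition dichromatic_number :: "('a,'b) pre_digraph \<Rightarrow> nat" where
  "dichromatic_number G = (LEAST k. \<exists>P. partition_on (verts G) P \<and> finite P \<and> card P = k \<and>
     (\<forall>S\<in>P. acyclic_digraph (G \<restriction> S)))"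

definition has_induced_copy :: "('c,'d) pre_digraph \<Rightarrow> ('a,'b) pre_digraph \<Rightarrow> bool" where
  "has_induced_copy H G \<longleftrightarrow> (\<exists>S \<subseteq> verts G. digraph_iso H (G \<restriction> S))"

definition hero :: "('c,'d) pre_digraph \<Rightarrow> ('a,'b) pre_digraph set \<Rightarrow> bool" where
  "hero H \<C> \<longleftrightarrow> (\<exists>c. \<forall>G\<in>\<C>. \<not> has_induced_copy H G \<longrightarrow> dichromatic_number G \<le> c)"

text \<open>Undirected graphs are represented, as in \<^theory>\<open>Graph_Theory.Digraph\<close>, by symmetric
  digraphs; in particular \<open>cycle_graph n\<close>, for \<open>n \<ge> 3\<close>, is the undirected cycle of length \<open>n\<close>.\<close>

definition cycle_graph :: "nat \<Rightarrow> (nat, nat \<times> nat) pre_digraph" where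
  "cycle_graph n = with_proj \<lparr> pverts = {..<n},
     parcs = {(i, j). i < n \<and> j < n \<and> (j = Suc i mod n \<or> i = Suc j mod n)} \<rparr>"

definition chordal :: "('a,'b) pre_digraph \<Rightarrow> bool" where
  "chordal U \<longleftrightarrow> \<not> (\<exists>n\<ge>4. has_induced_copy (cycle_graph n) U)"

definition chordal_orientations :: "('a,'b) pre_digraph set" where
  "chordal_orientations = {G. oriented_digraph G \<and> chordal (with_proj (mk_symmetric G))}"

definition TT :: "nat \<Rightarrow> (nat, nat \<times> nat) pre_digraph" where
  "TT k = with_proj \<lparr> pverts = {..<k}, parcs = {(i, j). i < j \<and> j < k} \<rparr>"

text \<open>\<open>Delta11 k\<close> is \<open>\<Delta>(1,1,k)\<close>, with \<open>x = k\<close>, \<open>y = k + 1\<close> and \<open>T = TT k\<close>.\<close>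

definition Delta11 :: "nat \<Rightarrow> (nat, nat \<times> nat) pre_digraph" where
  "Delta11 k = (let x = k; y = k + 1; T = TT k in
     with_proj \<lparr> pverts = {x, y} \<union> verts T,
       parcs = {(x, y)} \<union> {y} \<times> verts T \<union> verts T \<times> {x} \<union> arcs T \<rparr>)"

text \<open>Well-formedness of the pattern matters: \<^const>\<open>digraph_iso\<close> is false whenever its first
  argument is not well-formed.\<close>

lemma wf_cycle_graph: "wf_digraph (cycle_graph n)"
  by unfold_locales (auto simp: cycle_graph_def)

lemma oriented_digraph_TT: "oriented_digraph (TT k)"
proof -
  have "finite {(i, j). i < j \<and> j < k}"
    by (rule finite_subset[of _ "{..<k} \<times> {..<k}"]) auto
  then show ?thesis
    by unfold_locales (auto simp: TT_def arc_to_ends_def)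
qed

lemma oriented_digraph_Delta11: "oriented_digraph (Delta11 k)"
proof -
  have "finite {(i, j). i < j \<and> j < k}"
    by (rule finite_subset[of _ "{..<k} \<times> {..<k}"]) auto
  then show ?thesis
    by unfold_locales (auto simp: Delta11_def TT_def arc_to_ends_def)
qed

end

theory Submission
  imports Defs
begin

text \<open>A chordal graph has a simplicial vertex \<open>v\<close> (Dirac), so one may colour greedily, adding \<open>v\<close>
  last. Since the neighbours of \<open>v\<close> form a tournament, every directed cycle through \<open>v\<close> either
  contains a directed triangle \<open>v \<rightarrow> a \<rightarrow> b \<rightarrow> v\<close> or can be shortened so as to avoid \<open>v\<close>; hence it is
  enough that the colour of \<open>v\<close> creates no monochromatic directed triangle. Without \<open>TT k\<close> the
  clique around \<open>v\<close> has fewer than \<open>2 ^ (k - 1)\<close> vertices, so some colour does not occur there at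
  all. Without \<open>\<Delta>(1,1,k)\<close>, suppose all \<open>2 ^ (2 * k - 2)\<close> colours \<open>c\<close> are blocked by triangles
  \<open>v \<rightarrow> a c \<rightarrow> b c \<rightarrow> v\<close>. The \<open>b c\<close> are distinct, so they contain a transitive tournament on
  \<open>2 * k - 1\<close> vertices, with source \<open>x\<close>, say. The vertex \<open>a\<close> belonging to \<open>x\<close> either dominates \<open>k\<close>
  of these vertices, which form \<open>\<Delta>(1,1,k)\<close> with the arc \<open>v \<rightarrow> a\<close>, or is dominated by \<open>k\<close> of them,
  which form \<open>\<Delta>(1,1,k)\<close> with the arc \<open>a \<rightarrow> x\<close>.\<close>

section \<open>Shortest paths and simplicial vertices of chordal graphs\<close>

text \<open>On a walk of least length, a repeated vertex or a forward arc skipping a vertex would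
  give a shorter walk.\<close>

lemma induced_path:
  assumes "(s, t) \<in> R\<^sup>*"
  obtains n p where "p 0 = s" "p n = t" "\<And>i. i < n \<Longrightarrow> (p i, p (Suc i)) \<in> R" "inj_on p {..n}"
    "\<And>i j. i < j \<Longrightarrow> j \<le> n \<Longrightarrow> (p i, p j) \<in> R \<Longrightarrow> j = Suc i"
proof -
  define n where "n = (LEAST n. (s, t) \<in> R ^^ n)"
  have ex: "\<exists>n. (s, t) \<in> R ^^ n"
    using assms rtrancl_imp_UN_relpow by fast
  have n: "(s, t) \<in> R ^^ n"
    unfolding n_def using ex by (rule LeastI_ex)
  have min: "n \<le> m" if "(s, t) \<in> R ^^ m" for m
    unfolding n_def using that by (rule Least_le)
  obtain p where p: "p 0 = s" "p n = t" "\<And>i. i < n \<Longrightarrow> (p i, p (Suc i)) \<in> R"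
    using n by (auto simp: relpow_fun_conv)
  have walk: "(p i, p j) \<in> R ^^ (j - i)" if "i \<le> j" "j \<le> n" for i j
    unfolding relpow_fun_conv using that p(3) by (intro exI[of _ "\<lambda>l. p (i + l)"]) auto
  \<comment> \<open>Following \<open>p\<close> up to \<open>p i\<close>, taking \<open>m\<close>
    steps to \<open>p j\<close> and following \<open>p\<close> to its end costs
    \<open>i + m + (n - j)\<close> steps, which is at least \<open>n\<close>.\<close>
  have long: "j \<le> i + m" if "i \<le> n" "j \<le> n" "(p i, p j) \<in> R ^^ m" for i j m
  proof -
    have "(s, t) \<in> R ^^ i O R ^^ m O R ^^ (n - j)"
      using walk[of 0 i] walk[of j n] p that by auto
    then have "(s, t) \<in> R ^^ (i + m + (n - j))"
      by (simp add: relpow_add O_assoc)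
    then show ?thesis using min that by fastforce
  qed
  show ?thesis
  proof (rule that[OF p])
    show "inj_on p {..n}"
    proof (rule inj_onI)
      fix i j assume "i \<in> {..n}" "j \<in> {..n}" "p i = p j"
      then show "i = j" using long[of i j 0] long[of j i 0] by simp
    qed
    show "j = Suc i" if "i < j" "j \<le> n" "(p i, p j) \<in> R" for i j
      using long[of i j 1] that by simp
  qed auto
qed

text \<open>Chordality of a bare relation on a vertex set, so that deleting vertices only shrinks
  \<open>V\<close>; \<open>f\<close> runs once around an induced cycle of length
  \<open>n\<close>.\<close>

definition chordal_on :: "('a \<times> 'a) set \<Rightarrow> 'a set \<Rightarrow> bool" where
  "chordal_on E V \<longleftrightarrow> \<not> (\<exists>n\<ge>4. \<exists>f. inj_on f {..<n} \<and> f ` {..<n} \<subseteq> V \<and>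
     (\<forall>i<n. \<forall>j<n. (f i, f j) \<in> E \<longleftrightarrow> j = Suc i mod n \<or> i = Suc j mod n))"

lemma chordal_on_subset: "chordal_on E V \<Longrightarrow> W \<subseteq> V \<Longrightarrow> chordal_on E W"
  unfolding chordal_on_def by (meson subset_trans)

definition simplicial_in :: "('a \<times> 'a) set \<Rightarrow> 'a set \<Rightarrow> 'a \<Rightarrow> bool" where
  "simplicial_in E V v \<longleftrightarrow> v \<in> V \<and>
     (\<forall>x\<in>V. \<forall>y\<in>V. (v, x) \<in> E \<longrightarrow> (v, y) \<in> E \<longrightarrow> x \<noteq> y \<longrightarrow> (x, y) \<in> E)"

text \<open>A shortest path from \<open>s\<close> to \<open>t\<close> through \<open>U\<close> would close up to an induced cycle through \<open>v\<close>.\<close>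

lemma chordal_on_no_detour:
  assumes "chordal_on E V" "sym E" "irrefl E"
    and "v \<in> V" "s \<in> V" "t \<in> V" "(v, s) \<in> E" "(v, t) \<in> E" "s \<noteq> t" "(s, t) \<notin> E"
    and U: "U \<subseteq> V" "v \<notin> U" "\<And>u. u \<in> U \<Longrightarrow> (v, u) \<notin> E"
  shows "(s, t) \<notin> (Restr E (insert s (insert t U)))\<^sup>*"
proof
  assume "(s, t) \<in> (Restr E (insert s (insert t U)))\<^sup>*"
  then obtain n p where p: "p 0 = s" "p n = t"
    and edge: "\<And>i. i < n \<Longrightarrow> (p i, p (Suc i)) \<in> Restr E (insert s (insert t U))"
    and inj: "inj_on p {..n}"
    and chordless: "\<And>i j. i < j \<Longrightarrow> j \<le> n \<Longrightarrow> (p i, p j) \<in> Restr E (insert s (insert t U)) \<Longrightarrow> j = Suc i"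
    by (rule induced_path) blast
  \<comment> \<open>The cycle built below has \<open>n + 2\<close> vertices, so
    \<open>2 \<le> n\<close> gives it the length 4 that chordality forbids.\<close>
  have "n \<noteq> 0" using p \<open>s \<noteq> t\<close> by (metis)
  moreover have "n \<noteq> 1" using p edge[of 0] \<open>(s, t) \<notin> E\<close> by auto
  ultimately have n: "2 \<le> n" by simp
  have pX: "p i \<in> insert s (insert t U)" if "i \<le> n" for i
    using edge[of i] p(2) that by (cases "i = n") auto
  have vs: "v \<noteq> s" "v \<noteq> t" using assms by (auto simp: irrefl_def)
  have E_sym: "(x, y) \<in> E \<longleftrightarrow> (y, x) \<in> E" for x y using \<open>sym E\<close> by (auto dest: symD)
  have E_irr: "(x, x) \<notin> E" for x using \<open>irrefl E\<close> by (auto simp: irrefl_def)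
  \<comment> \<open>Inner vertices of the path differ from \<open>s\<close> and \<open>t\<close>,
    hence lie in \<open>U\<close>, where \<open>v\<close> has no neighbours.\<close>
  have edge_v: "(v, p i) \<in> E \<longleftrightarrow> i = 0 \<or> i = n" if "i \<le> n" for i
  proof (cases "i = 0 \<or> i = n")
    case False
    then have "p i \<noteq> s" "p i \<noteq> t"
      using p that inj_onD[OF inj, of i 0] inj_onD[OF inj, of i n] by auto
    then show ?thesis using pX[OF that] U False by auto
  qed (use p assms in auto)
  have edge_less: "(p i, p j) \<in> E \<longleftrightarrow> j = Suc i" if "i < j" "j \<le> n" for i j
  proof
    assume "(p i, p j) \<in> E"
    moreover have "p i \<in> insert s (insert t U)" "p j \<in> insert s (insert t U)"
      using pX that by simp_all
    ultimately show "j = Suc i" using chordless[OF that] by blast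
  next
    assume "j = Suc i"
    then show "(p i, p j) \<in> E" using edge[of i] that by simp
  qed
  have edge_p: "(p i, p j) \<in> E \<longleftrightarrow> j = Suc i \<or> i = Suc j" if "i \<le> n" "j \<le> n" for i j
    using edge_less[of i j] edge_less[of j i] that E_irr E_sym[of "p i" "p j"]
    by (cases i j rule: linorder_cases) auto
  \<comment> \<open>The cycle starts at \<open>v\<close> with index 0, so \<open>p i\<close> has
    index \<open>Suc i\<close> and the closing edge joins \<open>p n = t\<close> to
    \<open>v\<close>.\<close>
  define f where "f = case_nat v p"
  have mod_n: "Suc i mod (n + 2) = (if i = Suc n then 0 else Suc i)" if "i < n + 2" for i
    using that by auto
  have "inj_on f {..<n + 2}"
  proof (rule inj_onI)
    fix i j assume "i \<in> {..<n + 2}" "j \<in> {..<n + 2}" "f i = f j"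
    moreover have "v \<noteq> p i" if "i \<le> n" for i
      using pX[OF that] vs U(2) by auto
    ultimately show "i = j"
      using inj by (auto simp: f_def inj_on_def less_Suc_eq_le split: nat.splits)
  qed
  moreover have "f i \<in> V" if "i < n + 2" for i
    using pX[of "i - 1"] U(1) assms(4-6) that by (cases i) (auto simp: f_def)
  then have "f ` {..<n + 2} \<subseteq> V" by auto
  moreover have "(f i, f j) \<in> E \<longleftrightarrow> j = Suc i mod (n + 2) \<or> i = Suc j mod (n + 2)"
    if "i < n + 2" "j < n + 2" for i j
    unfolding mod_n[OF that(1)] mod_n[OF that(2)]
    using that edge_v edge_p E_irr E_sym[of v]
    by (cases i; cases j) (auto simp: f_def)
  ultimately show False
    using \<open>chordal_on E V\<close> n unfolding chordal_on_def
    by (elim notE, intro exI[of _ "n + 2"] conjI exI[of _ f]) auto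
qed

text \<open>Dirac's theorem, strengthened for the induction: the freedom to choose the vertex that
  \<open>w\<close> must not be adjacent to steers the simplicial vertex of a smaller graph away from
  the clique \<open>S\<close>.\<close>

lemma simplicial_nonadjacent:
  assumes "finite V" "chordal_on E V" "sym E" "irrefl E"
    and "v \<in> V" "u \<in> V" "u \<noteq> v" "(v, u) \<notin> E"
  shows "\<exists>w. simplicial_in E V w \<and> w \<noteq> v \<and> (v, w) \<notin> E"
  using assms
proof (induction V arbitrary: v u rule: finite_psubset_induct)
  case (psubset V)
  note sym = \<open>sym E\<close>
  \<comment> \<open>\<open>C\<close> is the component of \<open>u\<close> in the graph without \<open>v\<close> and its neighbours. Its
    attachment set \<open>S\<close> is a clique, so a simplicial vertex of \<open>C \<union> S\<close> that is not adjacent to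
    some vertex of \<open>S\<close>, or to some vertex of \<open>C\<close> if \<open>S\<close> is universal, lies in \<open>C\<close>.\<close>
  define U where "U = {x \<in> V. x \<noteq> v \<and> (v, x) \<notin> E}"
  define C where "C = (Restr E U)\<^sup>* `` {u}"
  define S where "S = {x \<in> V. (v, x) \<in> E \<and> (\<exists>c\<in>C. (c, x) \<in> E)}"
  have symU: "sym ((Restr E U)\<^sup>*)"
    using sym by (intro sym_rtrancl) (auto simp: sym_def)
  have uU: "u \<in> U" using psubset.prems by (simp add: U_def)
  have CU: "C \<subseteq> U"
  proof
    fix c assume "c \<in> C"
    then have "(u, c) \<in> (Restr E U)\<^sup>*" by (simp add: C_def)
    then show "c \<in> U" using uU by (induction rule: rtrancl_induct) auto
  qed
  have uC: "u \<in> C" by (simp add: C_def)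
  have nbr: "x \<in> C \<union> S" if "c \<in> C" "x \<in> V" "(c, x) \<in> E" for c x
  proof (cases "x \<in> U")
    case True
    then have "(c, x) \<in> Restr E U" using that CU by auto
    then show ?thesis using that(1) by (auto simp: C_def intro: rtrancl_into_rtrancl)
  next
    case False
    then have "(v, x) \<in> E"
      using that CU sym by (auto simp: U_def dest: symD)
    then show ?thesis using that by (auto simp: S_def)
  qed
  have clique: "(s, t) \<in> E" if ST: "s \<in> S" "t \<in> S" "s \<noteq> t" for s t
  proof (rule ccontr)
    \<comment> \<open>Nonadjacent \<open>s\<close> and \<open>t\<close> would be joined by a path
      through the connected set \<open>C\<close>, which contains neither \<open>v\<close> nor a
      neighbour of \<open>v\<close>.\<close>
    assume st: "(s, t) \<notin> E"
    obtain c d where cd: "c \<in> C" "(s, c) \<in> E" "d \<in> C" "(d, t) \<in> E"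
      using ST sym by (auto simp: S_def dest: symD)
    let ?R = "Restr E (insert s (insert t U))"
    have "(c, d) \<in> (Restr E U)\<^sup>*"
      using cd symU unfolding C_def by (auto dest: symD intro: rtrancl_trans)
    then have "(c, d) \<in> ?R\<^sup>*"
      by (rule subsetD[OF rtrancl_mono, rotated]) auto
    moreover have "(s, c) \<in> ?R" "(d, t) \<in> ?R" using cd CU by auto
    ultimately have "(s, t) \<in> ?R\<^sup>*"
      by (meson converse_rtrancl_into_rtrancl rtrancl_into_rtrancl)
    moreover have "(s, t) \<notin> ?R\<^sup>*"
      using psubset.prems ST st by (intro chordal_on_no_detour[where v = v and V = V]) (auto simp: S_def U_def)
    ultimately show False by simp
  qed
  define W where "W = C \<union> S"
  have WV: "W \<subset> V"
  proof -
    have "W \<subseteq> V" using CU by (auto simp: W_def S_def U_def)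
    moreover have "v \<notin> W" using CU \<open>irrefl E\<close> by (auto simp: W_def S_def U_def irrefl_def)
    ultimately show ?thesis using \<open>v \<in> V\<close> by auto
  qed
  have IH: "\<exists>w. simplicial_in E W w \<and> w \<noteq> x \<and> (x, w) \<notin> E"
    if "x \<in> W" "y \<in> W" "y \<noteq> x" "(x, y) \<notin> E" for x y
    using psubset.IH[OF WV] chordal_on_subset[OF \<open>chordal_on E V\<close>] WV psubset.prems that by blast
  have "\<exists>w\<in>C. simplicial_in E W w"
  proof (cases "\<exists>s\<in>S. \<exists>y\<in>W. y \<noteq> s \<and> (s, y) \<notin> E")
    case True
    then obtain s w where "s \<in> S" "simplicial_in E W w" "w \<noteq> s" "(s, w) \<notin> E"
      using IH unfolding W_def by blast
    then show ?thesis using clique by (auto simp: simplicial_in_def W_def)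
  next
    case univ: False
    show ?thesis
    proof (cases "\<exists>c\<in>C. \<exists>y\<in>W. y \<noteq> c \<and> (c, y) \<notin> E")
      case True
      then obtain c w where c: "c \<in> C" "simplicial_in E W w" "w \<noteq> c" "(c, w) \<notin> E"
        using IH unfolding W_def by blast
      have "w \<notin> S"
      proof
        assume "w \<in> S"
        then have "(w, c) \<in> E" using c(1,3) univ by (auto simp: W_def)
        then show False using c(4) sym by (auto dest: symD)
      qed
      then show ?thesis using c by (auto simp: simplicial_in_def W_def)
    next
      case False
      \<comment> \<open>Now \<open>W\<close> is a clique, so each of its vertices is simplicial in
        it, in particular \<open>u\<close>, which lies in \<open>C\<close>.\<close>
      then have "(x, y) \<in> E" if "x \<in> W" "y \<in> W" "x \<noteq> y" for x y
        using univ that by (metis Un_iff W_def)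
      then have "simplicial_in E W u"
        using uC by (simp add: simplicial_in_def W_def)
      then show ?thesis using uC by auto
    qed
  qed
  then obtain w where w: "w \<in> C" "simplicial_in E W w" by auto
  \<comment> \<open>By \<open>nbr\<close>, every neighbour in \<open>V\<close> of a vertex of
    \<open>C\<close> already lies in \<open>W\<close>.\<close>
  then have "simplicial_in E V w"
    using nbr[OF w(1)] WV by (auto simp: simplicial_in_def W_def)
  then show ?case using w CU by (auto simp: U_def)
qed

lemma chordal_on_simplicial:
  assumes "finite V" "chordal_on E V" "sym E" "irrefl E" "V \<noteq> {}"
  obtains v where "simplicial_in E V v"
proof (cases "\<exists>v\<in>V. \<exists>u\<in>V. u \<noteq> v \<and> (v, u) \<notin> E")
  case True
  then show ?thesis using simplicial_nonadjacent assms that by metis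
next
  case False
  moreover obtain v where "v \<in> V" using \<open>V \<noteq> {}\<close> by blast
  ultimately have "simplicial_in E V v" by (auto simp: simplicial_in_def)
  then show ?thesis by (rule that)
qed

section \<open>Tournaments and transitive subtournaments\<close>

definition tournament_on :: "('a \<times> 'a) set \<Rightarrow> 'a set \<Rightarrow> bool" where
  "tournament_on A K \<longleftrightarrow> (\<forall>x\<in>K. \<forall>y\<in>K. x \<noteq> y \<longrightarrow> (x, y) \<in> A \<or> (y, x) \<in> A)"

lemma tournament_on_subset: "tournament_on A K \<Longrightarrow> L \<subseteq> K \<Longrightarrow> tournament_on A L"
  by (auto simp: tournament_on_def)

text \<open>A transitive tournament listed from source to sink, so that \<open>take\<close> and
  \<open>filter\<close> produce subtournaments.\<close>

definition transitive_list :: "('a \<times> 'a) set \<Rightarrow> 'a list \<Rightarrow> bool" where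
  "transitive_list A xs \<longleftrightarrow> sorted_wrt (\<lambda>x y. (x, y) \<in> A) xs"

text \<open>Out- and in-neighbours of a vertex \<open>v\<close> cover the other vertices, so one of
  the two sets has at least \<open>2 ^ k\<close> elements; \<open>v\<close> goes before or after a
  list found there.\<close>

lemma tournament_transitive_list:
  assumes "finite K" "tournament_on A K" "2 ^ k \<le> card K"
  shows "\<exists>xs. transitive_list A xs \<and> set xs \<subseteq> K \<and> length xs = Suc k"
  using assms
proof (induction k arbitrary: K)
  case 0
  then obtain x where "x \<in> K" by fastforce
  then show ?case by (intro exI[of _ "[x]"]) (auto simp: transitive_list_def)
next
  case (Suc k)
  then obtain v where v: "v \<in> K" by fastforce
  define O' where "O' = {x \<in> K - {v}. (v, x) \<in> A}"
  define I where "I = {x \<in> K - {v}. (x, v) \<in> A}"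
  have sub: "finite O'" "finite I" "tournament_on A O'" "tournament_on A I"
    using Suc.prems by (auto simp: O'_def I_def tournament_on_def)
  have "K = insert v (O' \<union> I)"
    using v Suc.prems(2) by (auto simp: O'_def I_def tournament_on_def)
  then have "card K \<le> Suc (card O' + card I)"
    by (metis card_Un_le card_insert_le_m1 card_insert_if finite_UnI sub(1,2) Suc_le_mono le_SucI)
  then consider "2 ^ k \<le> card O'" | "2 ^ k \<le> card I"
    using Suc.prems(3) by fastforce
  then show ?case
  proof cases
    case 1
    then obtain xs where "transitive_list A xs" "set xs \<subseteq> O'" "length xs = Suc k"
      using Suc.IH sub by blast
    then show ?thesis
      using v by (intro exI[of _ "v # xs"]) (auto simp: transitive_list_def O'_def)
  next
    case 2
    then obtain xs where "transitive_list A xs" "set xs \<subseteq> I" "length xs = Suc k"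
      using Suc.IH sub by blast
    then show ?thesis
      using v by (intro exI[of _ "xs @ [v]"]) (auto simp: transitive_list_def I_def sorted_wrt_append)
  qed
qed

section \<open>Extending a dicolouring by a simplicial vertex\<close>

text \<open>A passage \<open>a \<rightarrow> v \<rightarrow> b\<close> can be replaced by the arc
  \<open>a \<rightarrow> b\<close>, since the opposite arc would close the triangle
  \<open>v \<rightarrow> b \<rightarrow> a \<rightarrow> v\<close>. A cycle through \<open>v\<close>
  would thus give one inside \<open>S\<close>.\<close>

lemma acyclic_insert_simplicial:
  assumes acyc: "acyclic (Restr A S)" and asym: "asym A"
    and tour: "tournament_on A {x \<in> S. (v, x) \<in> A \<or> (x, v) \<in> A}"
    and no_tri: "\<And>a b. a \<in> S \<Longrightarrow> b \<in> S \<Longrightarrow> (v, a) \<in> A \<Longrightarrow> (a, b) \<in> A \<Longrightarrow> (b, v) \<notin> A"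
  shows "acyclic (Restr A (insert v S))"
proof -
  let ?R = "Restr A (insert v S)" and ?Q = "Restr A S"
  have asymD: "(x, y) \<in> A \<Longrightarrow> (y, x) \<notin> A" for x y using asym by (auto dest: asymD)
  have shortcut: "(a, b) \<in> ?Q" if "a \<in> S" "b \<in> S" "(a, v) \<in> A" "(v, b) \<in> A" for a b
    using tour no_tri[of b a] that asymD unfolding tournament_on_def by fastforce
  \<comment> \<open>Invariant of a walk that starts outside \<open>v\<close>: either its end is
    reached inside \<open>S\<close>, or it stands at \<open>v\<close> and the preceding vertex
    \<open>c\<close> is reached inside \<open>S\<close>.\<close>
  have trancl: "(b \<noteq> v \<longrightarrow> (a, b) \<in> ?Q\<^sup>+) \<and> (b = v \<longrightarrow> (\<exists>c\<in>S. (a, c) \<in> ?Q\<^sup>* \<and> (c, v) \<in> A))"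
    if "(a, b) \<in> ?R\<^sup>+" "a \<noteq> v" for a b
    using that
  proof (induction rule: trancl_induct)
    case (base b)
    then show ?case using asymD by auto
  next
    case (step b c)
    show ?case
    proof (cases "b = v")
      case True
      then obtain d where d: "d \<in> S" "(a, d) \<in> ?Q\<^sup>*" "(d, v) \<in> A" using step by auto
      have "c \<noteq> v" using step True asymD by auto
      moreover have "(d, c) \<in> ?Q" using shortcut d step True calculation by auto
      ultimately show ?thesis using d by (auto intro: rtrancl_into_trancl1)
    next
      case False
      then show ?thesis using step by (auto intro: trancl_into_trancl trancl_into_rtrancl)
    qed
  qed
  have no_loop: "(a, a) \<notin> ?R\<^sup>+" if "a \<noteq> v" for a
    using trancl[OF _ that, of a] acyc that by (auto simp: acyclic_def)
  have "(v, v) \<notin> ?R\<^sup>+"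
  proof
    assume v: "(v, v) \<in> ?R\<^sup>+"
    \<comment> \<open>The second vertex \<open>a\<close> of the closed walk differs from
      \<open>v\<close>; started there, the walk falls under \<open>no_loop\<close>.\<close>
    then obtain a where a: "(v, a) \<in> ?R" "(a, v) \<in> ?R\<^sup>*" by (auto dest: tranclD)
    have "a \<noteq> v" using a asymD by auto
    moreover have "(a, a) \<in> ?R\<^sup>+" using a by (auto intro: rtrancl_into_trancl1)
    ultimately show False using no_loop by blast
  qed
  with no_loop have "(a, a) \<notin> ?R\<^sup>+" for a by (cases "a = v") auto
  then show ?thesis by (simp add: acyclic_def)
qed

text \<open>The part common to both bounds: \<open>free\<close> offers, for any colouring of a
  clique around \<open>v\<close>, a colour that closes no monochromatic triangle at
  \<open>v\<close>. It passes to subsets of \<open>V\<close>, so a simplicial vertex can be deleted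
  and coloured last.\<close>

lemma greedy_dicolouring:
  assumes "finite V" "asym A" "chordal_on (A \<union> A\<inverse>) V"
    and free: "\<And>v K f. v \<in> V \<Longrightarrow> K \<subseteq> V - {v} \<Longrightarrow> tournament_on A (insert v K) \<Longrightarrow>
      \<exists>c<m::nat. \<forall>a\<in>K. \<forall>b\<in>K. f a = c \<longrightarrow> f b = c \<longrightarrow> (v, a) \<in> A \<longrightarrow> (a, b) \<in> A \<longrightarrow> (b, v) \<notin> A"
  shows "\<exists>f. f ` V \<subseteq> {..<m} \<and> (\<forall>c. acyclic (Restr A {x \<in> V. f x = c}))"
  using assms
proof (induction V rule: finite_psubset_induct)
  case (psubset V)
  let ?E = "A \<union> A\<inverse>"
  have E: "sym ?E" "irrefl ?E"
    using \<open>asym A\<close> by (auto simp: sym_def irrefl_def dest: asymD)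
  show ?case
  proof (cases "V = {}")
    case True
    then show ?thesis by (auto simp: acyclic_def)
  next
    case False
    then obtain v where v: "simplicial_in ?E V v"
      using chordal_on_simplicial E psubset by metis
    then have vV: "v \<in> V" by (simp add: simplicial_in_def)
    have "\<exists>f. f ` (V - {v}) \<subseteq> {..<m} \<and> (\<forall>c. acyclic (Restr A {x \<in> V - {v}. f x = c}))"
    proof (rule psubset.IH)
      show "chordal_on ?E (V - {v})" using psubset.prems(2) by (rule chordal_on_subset) auto
      show "\<exists>c<m. \<forall>a\<in>K. \<forall>b\<in>K. f a = c \<longrightarrow> f b = c \<longrightarrow> (u, a) \<in> A \<longrightarrow> (a, b) \<in> A \<longrightarrow> (b, u) \<notin> A"
        if "u \<in> V - {v}" "K \<subseteq> V - {v} - {u}" "tournament_on A (insert u K)" for u K and f :: "'a \<Rightarrow> nat"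
        using that by (intro psubset.prems(3)) auto
    qed (use vV psubset.prems in auto)
    then obtain f where f: "f ` (V - {v}) \<subseteq> {..<m}" "\<And>c. acyclic (Restr A {x \<in> V - {v}. f x = c})"
      by blast
    define K where "K = {x \<in> V. (v, x) \<in> ?E}"
    have K: "tournament_on A (insert v K)" "K \<subseteq> V - {v}"
      using v E by (auto simp: tournament_on_def simplicial_in_def K_def irrefl_def)
    then obtain c where c: "c < m" "\<And>a b. a \<in> K \<Longrightarrow> b \<in> K \<Longrightarrow> f a = c \<Longrightarrow> f b = c \<Longrightarrow>
        (v, a) \<in> A \<Longrightarrow> (a, b) \<in> A \<Longrightarrow> (b, v) \<notin> A"
      using psubset.prems(3)[OF vV K(2,1)] by meson
    have "acyclic (Restr A {x \<in> V. (f(v := c)) x = d})" for d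
    proof (cases "d = c")
      case True
      have "acyclic (Restr A (insert v {x \<in> V - {v}. f x = c}))"
      proof (rule acyclic_insert_simplicial[OF f(2) \<open>asym A\<close>])
        show "tournament_on A {x \<in> {x \<in> V - {v}. f x = c}. (v, x) \<in> A \<or> (x, v) \<in> A}"
          using K(1) by (rule tournament_on_subset) (auto simp: K_def)
        show "(b, v) \<notin> A"
          if "a \<in> {x \<in> V - {v}. f x = c}" "b \<in> {x \<in> V - {v}. f x = c}" "(v, a) \<in> A" "(a, b) \<in> A" for a b
        proof
          assume "(b, v) \<in> A"
          then show False using c(2)[of a b] that by (auto simp: K_def)
        qed
      qed
      moreover have "{x \<in> V. (f(v := c)) x = d} = insert v {x \<in> V - {v}. f x = c}"
        using True vV by auto
      ultimately show ?thesis by simp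
    next
      case False
      then have "{x \<in> V. (f(v := c)) x = d} = {x \<in> V - {v}. f x = d}" by auto
      then show ?thesis using f(2) by simp
    qed
    moreover have "(f(v := c)) ` V \<subseteq> {..<m}" using f(1) c(1) by auto
    ultimately show ?thesis by blast
  qed
qed

section \<open>Colours left free by a clique\<close>

text \<open>The tournament \<open>insert v K\<close> has at most \<open>2 ^ k - 1\<close> vertices,
  so \<open>K\<close> has at most \<open>2 ^ k - 2\<close>, one fewer than there are
  colours.\<close>

lemma transitive_list_free_colour:
  assumes "finite K" "v \<notin> K" "tournament_on A (insert v K)"
    and "\<And>xs. transitive_list A xs \<Longrightarrow> set xs \<subseteq> insert v K \<Longrightarrow> length xs \<noteq> Suc k"
  shows "\<exists>c<2 ^ k - 1 :: nat. c \<notin> f ` K"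
proof -
  have "card (insert v K) < 2 ^ k"
    using tournament_transitive_list[of "insert v K" A k] assms by (meson finite_insert not_less)
  then have "card (f ` K) < card {..<2 ^ k - 1 :: nat}"
    using card_image_le[OF assms(1), of f] assms(1,2) by simp
  then have "\<not> {..<2 ^ k - 1 :: nat} \<subseteq> f ` K"
    using assms(1) by (metis card_mono finite_imageI not_less)
  then show ?thesis by auto
qed

text \<open>A copy of \<open>\<Delta>(1,1,k)\<close> with \<open>k = length ts\<close>, where
  \<open>ts\<close> lists the transitive part.\<close>

definition delta_list :: "('a \<times> 'a) set \<Rightarrow> 'a \<Rightarrow> 'a \<Rightarrow> 'a list \<Rightarrow> bool" where
  "delta_list A x y ts \<longleftrightarrow> transitive_list A ts \<and> (x, y) \<in> A \<and> (\<forall>t\<in>set ts. (y, t) \<in> A \<and> (t, x) \<in> A)"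

lemma transitive_list_sublists:
  assumes "transitive_list A xs"
  shows "transitive_list A (take n xs)" "transitive_list A (filter P xs)"
  using assms by (auto simp: transitive_list_def sorted_wrt_take sorted_wrt_filter)

lemma delta_list_exists:
  assumes tour: "tournament_on A K" and "asym A" "v \<in> K" "set (x # ys) \<subseteq> K" "a \<in> K"
    and len: "length (x # ys) = 2 * k - 1" "k \<ge> 1"
    and trans: "transitive_list A (x # ys)"
    and arcs: "(v, a) \<in> A" "(a, x) \<in> A" "\<And>b. b \<in> set (x # ys) \<Longrightarrow> (b, v) \<in> A"
  shows "\<exists>x\<in>K. \<exists>y\<in>K. \<exists>ts. delta_list A x y ts \<and> set ts \<subseteq> K \<and> length ts = k"
proof -
  \<comment> \<open>As \<open>a \<rightarrow> x\<close>, the source \<open>x\<close> counts towards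
    \<open>os\<close>; so \<open>ns\<close> can be drawn from \<open>ys\<close> alone, all of which
    \<open>x\<close> dominates. One of the two parts of the \<open>2 * k - 1\<close> vertices has at
    least \<open>k\<close> elements.\<close>
  define os where "os = filter (\<lambda>t. (a, t) \<in> A) (x # ys)"
  define ns where "ns = filter (\<lambda>t. (a, t) \<notin> A) ys"
  have "length os + length ns = 2 * k - 1"
    using len sum_length_filter_compl[of "\<lambda>t. (a, t) \<in> A" ys] arcs by (simp add: os_def ns_def)
  then consider "k \<le> length os" | "k \<le> length ns" using len by linarith
  then show ?thesis
  proof cases
    case 1
    have "set (take k os) \<subseteq> set os" by (rule set_take_subset)
    then have sub: "set (take k os) \<subseteq> {t \<in> set (x # ys). (a, t) \<in> A}" by (auto simp: os_def)
    moreover have "transitive_list A (take k os)"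
      unfolding os_def using trans by (intro transitive_list_sublists)
    ultimately have "delta_list A v a (take k os)"
      using arcs by (auto simp: delta_list_def)
    moreover have "set (take k os) \<subseteq> K" using sub assms(4) by blast
    ultimately show ?thesis using 1 assms(3,5) by fastforce
  next
    case 2
    have "set (take k ns) \<subseteq> set ns" by (rule set_take_subset)
    then have sub: "set (take k ns) \<subseteq> {t \<in> set ys. (a, t) \<notin> A}" by (auto simp: ns_def)
    \<comment> \<open>Members of \<open>ys\<close> dominate \<open>v\<close>, whereas
      \<open>v \<rightarrow> a\<close>. Hence each member that \<open>a\<close> does not dominate is
      different from \<open>a\<close> and dominates it.\<close>
    have "a \<notin> set ys" using arcs \<open>asym A\<close> by (auto dest: asymD)
    have "(t, a) \<in> A" if "t \<in> set ys" "(a, t) \<notin> A" for t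
      using that \<open>a \<notin> set ys\<close> assms(4,5) tour unfolding tournament_on_def by auto
    moreover have "\<forall>t\<in>set ys. (x, t) \<in> A" "transitive_list A ys" using trans by (auto simp: transitive_list_def)
    moreover have "transitive_list A (take k ns)"
      unfolding ns_def using calculation by (intro transitive_list_sublists)
    ultimately have "delta_list A a x (take k ns)"
      using arcs sub by (auto simp: delta_list_def)
    moreover have "set (take k ns) \<subseteq> K" using sub assms(4) by auto
    ultimately show ?thesis using 2 assms(4,5) by fastforce
  qed
qed

lemma delta_list_free_colour:
  assumes "finite K" "tournament_on A (insert v K)" "asym A" "k \<ge> 1"
    and no_delta: "\<And>x y ts. delta_list A x y ts \<Longrightarrow> set (x # y # ts) \<subseteq> insert v K \<Longrightarrow> length ts \<noteq> k"
  shows "\<exists>c<2 ^ (2 * k - 2) :: nat. \<forall>a\<in>K. \<forall>b\<in>K. f a = c \<longrightarrow> f b = c \<longrightarrow>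
    (v, a) \<in> A \<longrightarrow> (a, b) \<in> A \<longrightarrow> (b, v) \<notin> A"
proof (rule ccontr)
  let ?m = "2 ^ (2 * k - 2) :: nat"
  assume "\<not> ?thesis"
  then have "\<forall>c<?m. \<exists>a b. a \<in> K \<and> b \<in> K \<and> f a = c \<and> f b = c \<and>
      (v, a) \<in> A \<and> (a, b) \<in> A \<and> (b, v) \<in> A"
    by blast
  then obtain a b where ab: "\<And>c. c < ?m \<Longrightarrow> a c \<in> K \<and> b c \<in> K \<and> f (a c) = c \<and> f (b c) = c \<and>
      (v, a c) \<in> A \<and> (a c, b c) \<in> A \<and> (b c, v) \<in> A"
    by metis
  define B where "B = b ` {..<?m}"
  \<comment> \<open>The vertex \<open>b c\<close> has colour \<open>c\<close>, so \<open>f\<close>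
    is a left inverse of \<open>b\<close>.\<close>
  have "inj_on b {..<?m}" by (rule inj_on_inverseI[of _ f]) (use ab in auto)
  then have "card B = ?m" by (simp add: B_def card_image)
  moreover have "B \<subseteq> K" "finite B" using ab by (auto simp: B_def)
  moreover have "tournament_on A B" using assms(2) by (rule tournament_on_subset) (use \<open>B \<subseteq> K\<close> in auto)
  ultimately obtain xs where xs: "transitive_list A xs" "set xs \<subseteq> B" "length xs = Suc (2 * k - 2)"
    using tournament_transitive_list[of B A "2 * k - 2"] by auto
  then obtain x ys where xys: "xs = x # ys" by (cases xs) auto
  \<comment> \<open>The colour whose blocking triangle contains the source \<open>x\<close>; its
    vertex \<open>a c\<close> serves as the \<open>a\<close> of
    \<open>delta_list_exists\<close>.\<close>
  then obtain c where c: "c < ?m" "x = b c" using xs(2) by (auto simp: B_def)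
  have "\<exists>x\<in>insert v K. \<exists>y\<in>insert v K. \<exists>ts. delta_list A x y ts \<and> set ts \<subseteq> insert v K \<and> length ts = k"
  proof (rule delta_list_exists[OF assms(2,3)])
    show "set (x # ys) \<subseteq> insert v K" using xs(2) xys \<open>B \<subseteq> K\<close> by auto
    show "length (x # ys) = 2 * k - 1" using xs(3) xys \<open>k \<ge> 1\<close> by simp
    show "transitive_list A (x # ys)" using xs(1) xys by simp
    show "a c \<in> insert v K" "(v, a c) \<in> A" "(a c, x) \<in> A" using ab c by auto
    show "(t, v) \<in> A" if "t \<in> set (x # ys)" for t using that xs(2) xys ab by (auto simp: B_def)
  qed (use \<open>k \<ge> 1\<close> in auto)
  then show False using no_delta by fastforce
qed

section \<open>From relations back to induced copies and dichromatic numbers\<close>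

text \<open>Without parallel arcs an arc is determined by its ends, so a vertex map preserving and
  reflecting adjacency extends uniquely to arcs.\<close>

lemma has_induced_copyI:
  assumes H: "wf_digraph H" "nomulti_digraph H" and G: "nomulti_digraph G"
    and inj: "inj_on f (verts H)" and sub: "f ` verts H \<subseteq> verts G"
    and adj: "\<And>u v. u \<in> verts H \<Longrightarrow> v \<in> verts H \<Longrightarrow> (u, v) \<in> arcs_ends H \<longleftrightarrow> (f u, f v) \<in> arcs_ends G"
  shows "has_induced_copy H G"
proof -
  interpret H: nomulti_digraph H by fact
  interpret G: nomulti_digraph G by fact
  define g where "g e = (THE e'. e' \<in> arcs G \<and> tail G e' = f (tail H e) \<and> head G e' = f (head H e))" for e
  have uniq: "e = e'" if "e \<in> arcs G" "e' \<in> arcs G" "tail G e = tail G e'" "head G e = head G e'" for e e'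
    using G.no_multi_arcs that by (auto simp: arc_to_ends_def)
  have uniqH: "e = e'" if "e \<in> arcs H" "e' \<in> arcs H" "tail H e = tail H e'" "head H e = head H e'" for e e'
    using H.no_multi_arcs that by (auto simp: arc_to_ends_def)
  have g_eq: "g e = e'" if "e' \<in> arcs G" "tail G e' = f (tail H e)" "head G e' = f (head H e)" for e e'
    unfolding g_def using that uniq by (intro the_equality) auto
  have g: "g e \<in> arcs G \<and> tail G (g e) = f (tail H e) \<and> head G (g e) = f (head H e)" if "e \<in> arcs H" for e
  proof -
    have "(tail H e, head H e) \<in> arcs_ends H" using that by (auto simp: arcs_ends_conv)
    then have "(f (tail H e), f (head H e)) \<in> arcs_ends G" using adj that by auto
    then obtain e' where "e' \<in> arcs G" "tail G e' = f (tail H e)" "head G e' = f (head H e)"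
      by (auto simp: arcs_ends_conv)
    then show ?thesis using g_eq by blast
  qed
  define S where "S = f ` verts H"
  have surj: "e' \<in> g ` arcs H" if e': "e' \<in> arcs G" "tail G e' \<in> S" "head G e' \<in> S" for e'
  proof -
    obtain u v where uv: "u \<in> verts H" "v \<in> verts H" "tail G e' = f u" "head G e' = f v"
      using e' by (auto simp: S_def)
    then have "(f u, f v) \<in> arcs_ends G" using e'(1) by (force simp: arcs_ends_conv)
    then have "(u, v) \<in> arcs_ends H" using adj uv by simp
    then obtain e where "e \<in> arcs H" "tail H e = u" "head H e = v"
      by (auto simp: arcs_ends_conv)
    then show ?thesis using g_eq[of e' e] e' uv by auto
  qed
  \<comment> \<open>\<open>app_iso h H\<close> has to equal \<open>G \<restriction> S\<close> as a
    record, so its head and tail maps are those of \<open>G\<close>.\<close>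
  define h where "h = \<lparr>iso_verts = f, iso_arcs = g, iso_head = head G, iso_tail = tail G\<rparr>"
  have "inj_on g (arcs H)"
  proof (rule inj_onI)
    fix e e' assume e: "e \<in> arcs H" "e' \<in> arcs H" "g e = g e'"
    then have "f (tail H e) = f (tail H e')" "f (head H e) = f (head H e')" using g by metis+
    then show "e = e'" using e uniqH inj_onD[OF inj] by simp
  qed
  then have "pre_digraph.digraph_isomorphism H h"
    using inj g H(1) by (auto simp: pre_digraph.digraph_isomorphism_def h_def)
  moreover have "G \<restriction> S = app_iso h H"
    using surj g by (auto simp: app_iso_def h_def induce_subgraph_def S_def)
  ultimately have "digraph_iso H (G \<restriction> S)" by (auto simp: digraph_iso_def)
  then show ?thesis using sub by (auto simp: has_induced_copy_def S_def)
qed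

text \<open>The symmetrised relation is the adjacency of \<open>mk_symmetric G\<close>, so a map
  \<open>f\<close> violating \<open>chordal_on\<close> embeds \<open>cycle_graph n\<close> as an
  induced copy.\<close>

lemma chordal_imp_chordal_on:
  assumes "digraph G" "chordal (with_proj (mk_symmetric G))"
  shows "chordal_on (arcs_ends G \<union> (arcs_ends G)\<inverse>) (verts G)"
  unfolding chordal_on_def
proof safe
  fix n f
  assume n: "4 \<le> n" and f: "inj_on f {..<n}" "f ` {..<n} \<subseteq> verts G"
    and adj: "\<forall>i<n. \<forall>j<n. (f i, f j) \<in> arcs_ends G \<union> (arcs_ends G)\<inverse> \<longleftrightarrow>
      j = Suc i mod n \<or> i = Suc j mod n"
  interpret digraph G by fact
  interpret S: pair_digraph "mk_symmetric G" by (rule digraph_mk_symmetric)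
  have "has_induced_copy (cycle_graph n) (with_proj (mk_symmetric G))"
  proof (rule has_induced_copyI)
    show "wf_digraph (cycle_graph n)" by (rule wf_cycle_graph)
    then show "nomulti_digraph (cycle_graph n)"
      by (auto simp: nomulti_digraph_def nomulti_digraph_axioms_def arc_to_ends_def cycle_graph_def)
    show "nomulti_digraph (with_proj (mk_symmetric G))" by unfold_locales
    have "arcs_ends (with_proj (mk_symmetric G)) = arcs_ends G \<union> (arcs_ends G)\<inverse>"
      by (auto simp: mk_symmetric_def arcs_ends_conv)
    then show "(i, j) \<in> arcs_ends (cycle_graph n) \<longleftrightarrow> (f i, f j) \<in> arcs_ends (with_proj (mk_symmetric G))"
      if "i \<in> verts (cycle_graph n)" "j \<in> verts (cycle_graph n)" for i j
      using adj that by (auto simp: cycle_graph_def arcs_ends_conv)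
  qed (use f in \<open>auto simp: cycle_graph_def mk_symmetric_def\<close>)
  then show False using assms(2) n by (auto simp: chordal_def)
qed

lemma acyclic_imp_acyclic_digraph:
  assumes "wf_digraph G" "acyclic (Restr (arcs_ends G) S)"
  shows "acyclic_digraph (G \<restriction> S)"
  unfolding acyclic_digraph_def
proof
  interpret S: wf_digraph "G \<restriction> S"
    using assms(1) by (rule wf_digraph.wellformed_induce_subgraph)
  assume "\<exists>p. pre_digraph.cycle (G \<restriction> S) p"
  then obtain u p where "S.awalk u p u" "p \<noteq> []" by (auto simp: S.cycle_def)
  then have "(u, u) \<in> (arcs_ends (G \<restriction> S))\<^sup>+" by (auto simp: S.reachable1_awalk)
  moreover have "arcs_ends (G \<restriction> S) \<subseteq> Restr (arcs_ends G) S" by (auto simp: arcs_ends_conv)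
  ultimately show False using assms(2) trancl_mono unfolding acyclic_def by blast
qed

lemma dichromatic_number_le:
  assumes "wf_digraph G" "finite (verts G)" "f ` verts G \<subseteq> {..<m::nat}"
    and "\<And>c. acyclic (Restr (arcs_ends G) {x \<in> verts G. f x = c})"
  shows "dichromatic_number G \<le> m"
proof -
  \<comment> \<open>Only colours that occur are used, because the parts of a partition must be
    non-empty.\<close>
  define P where "P = (\<lambda>c. {x \<in> verts G. f x = c}) ` f ` verts G"
  have "partition_on (verts G) P"
    by (rule partition_onI) (auto simp: P_def disjnt_def)
  moreover have "finite P" using assms(2) by (simp add: P_def)
  moreover have "\<forall>S\<in>P. acyclic_digraph (G \<restriction> S)"
    using assms(1,4) by (auto simp: P_def intro: acyclic_imp_acyclic_digraph)
  ultimately have "dichromatic_number G \<le> card P"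
    unfolding dichromatic_number_def by (intro Least_le) auto
  also have "\<dots> \<le> card (f ` verts G)"
    unfolding P_def using assms(2) by (intro card_image_le) auto
  also have "\<dots> \<le> m" using card_mono[OF _ assms(3)] by simp
  finally show ?thesis .
qed

lemma transitive_list_nth:
  assumes "transitive_list A xs" "asym A" "i < length xs" "j < length xs"
  shows "(xs ! i, xs ! j) \<in> A \<longleftrightarrow> i < j"
  using assms sorted_wrt_nth_less[of "\<lambda>x y. (x, y) \<in> A" xs]
  by (cases i j rule: linorder_cases) (auto simp: transitive_list_def dest: asymD)

lemma transitive_list_distinct:
  assumes "transitive_list A xs" "asym A"
  shows "distinct xs"
  using assms by (auto simp: transitive_list_def distinct_conv_nth sorted_wrt_iff_nth_less dest: asymD)
    (metis asymD linorder_neqE_nat)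

lemma has_induced_copy_TT:
  assumes "nomulti_digraph G" "asym (arcs_ends G)"
    and xs: "transitive_list (arcs_ends G) xs" "set xs \<subseteq> verts G"
  shows "has_induced_copy (TT (length xs)) G"
proof -
  interpret H: oriented_digraph "TT (length xs)" by (rule oriented_digraph_TT)
  show ?thesis
  proof (rule has_induced_copyI[of _ _ "(!) xs"])
    show "inj_on ((!) xs) (verts (TT (length xs)))"
      using transitive_list_distinct[OF xs(1) assms(2)] by (auto simp: TT_def inj_on_nth)
    show "(i, j) \<in> arcs_ends (TT (length xs)) \<longleftrightarrow> (xs ! i, xs ! j) \<in> arcs_ends G"
      if "i \<in> verts (TT (length xs))" "j \<in> verts (TT (length xs))" for i j
      using that transitive_list_nth[OF xs(1) assms(2)] by (auto simp: TT_def arcs_ends_conv)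
  qed (use assms H.wf_digraph H.nomulti_digraph in \<open>auto simp: TT_def\<close>)
qed

lemma arcs_ends_Delta11:
  "(i, j) \<in> arcs_ends (Delta11 k) \<longleftrightarrow>
    i = k \<and> j = Suc k \<or> i = Suc k \<and> j < k \<or> i < k \<and> j = k \<or> i < j \<and> j < k"
  by (auto simp: Delta11_def TT_def Let_def arcs_ends_conv)

lemma has_induced_copy_Delta11:
  assumes "nomulti_digraph G" "asym (arcs_ends G)"
    and d: "delta_list (arcs_ends G) x y ts" "set (x # y # ts) \<subseteq> verts G"
  shows "has_induced_copy (Delta11 (length ts)) G"
proof -
  let ?k = "length ts" and ?A = "arcs_ends G"
  interpret H: oriented_digraph "Delta11 ?k" by (rule oriented_digraph_Delta11)
  \<comment> \<open>This order matches the numbering of \<open>Delta11\<close>: the transitive part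
    first, then \<open>x\<close> at index \<open>?k\<close> and \<open>y\<close> at
    \<open>Suc ?k\<close>.\<close>
  define zs where "zs = ts @ [x, y]"
  have verts: "verts (Delta11 ?k) = {..<length zs}" by (auto simp: Delta11_def TT_def Let_def zs_def)
  have A: "(u, v) \<in> ?A \<Longrightarrow> (v, u) \<notin> ?A" for u v using assms(2) by (auto dest: asymD)
  have irrefl: "(u, u) \<notin> ?A" for u using A by blast
  have t: "transitive_list ?A ts" "(x, y) \<in> ?A" "\<And>t. t \<in> set ts \<Longrightarrow> (y, t) \<in> ?A" "\<And>t. t \<in> set ts \<Longrightarrow> (t, x) \<in> ?A"
    using d(1) by (auto simp: delta_list_def)
  have "distinct zs"
    using t A transitive_list_distinct[OF t(1) assms(2)] by (auto simp: zs_def)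
  show ?thesis
  proof (rule has_induced_copyI[of _ _ "(!) zs"])
    show "inj_on ((!) zs) (verts (Delta11 ?k))"
      using \<open>distinct zs\<close> by (auto simp: verts inj_on_nth)
    show "(i, j) \<in> arcs_ends (Delta11 ?k) \<longleftrightarrow> (zs ! i, zs ! j) \<in> ?A"
      if "i \<in> verts (Delta11 ?k)" "j \<in> verts (Delta11 ?k)" for i j
    proof -
      have "i < ?k \<or> i = ?k \<or> i = Suc ?k" "j < ?k \<or> j = ?k \<or> j = Suc ?k"
        using that by (auto simp: verts zs_def)
      then show ?thesis
        using t(2) t(3,4)[OF nth_mem] A irrefl transitive_list_nth[OF t(1) assms(2), of i j]
        by (elim disjE) (simp_all add: arcs_ends_Delta11 zs_def nth_append)
    qed
    have "set zs \<subseteq> verts G" using d(2) by (auto simp: zs_def)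
    then show "(!) zs ` verts (Delta11 ?k) \<subseteq> verts G"
      unfolding verts by (auto intro: nth_mem)
  qed (use assms H.wf_digraph H.nomulti_digraph in auto)
qed

lemma chordal_orientationsD:
  assumes "G \<in> chordal_orientations"
  shows "wf_digraph G" "nomulti_digraph G" "finite (verts G)" "asym (arcs_ends G)"
    "chordal_on (arcs_ends G \<union> (arcs_ends G)\<inverse>) (verts G)"
proof -
  interpret oriented_digraph G using assms by (simp add: chordal_orientations_def)
  show "wf_digraph G" "nomulti_digraph G" "finite (verts G)" by unfold_locales simp
  show "asym (arcs_ends G)" using no_digons by (auto simp: asym_on_def)
  show "chordal_on (arcs_ends G \<union> (arcs_ends G)\<inverse>) (verts G)"
    using assms by (intro chordal_imp_chordal_on) (auto simp: chordal_orientations_def, unfold_locales)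
qed

section \<open>The bounds for orientations of chordal graphs\<close>

lemma dichromatic_number_TT_free:
  assumes "G \<in> chordal_orientations" "\<not> has_induced_copy (TT k) G" "k \<ge> 1"
  shows "dichromatic_number G \<le> 2 ^ (k - 1) - 1"
proof -
  note G = chordal_orientationsD[OF assms(1)]
  \<comment> \<open>Since \<open>k \<ge> 1\<close>, the forbidden length \<open>k\<close> is
    \<open>Suc (k - 1)\<close>, the form in which \<open>transitive_list_free_colour\<close>
    excludes lists; this puts \<open>k - 1\<close> into the exponent.\<close>
  have no_TT: "length xs \<noteq> Suc (k - 1)" if "transitive_list (arcs_ends G) xs" "set xs \<subseteq> verts G" for xs
    using has_induced_copy_TT[OF G(2,4) that] assms(2,3) by auto
  have "\<exists>f. f ` verts G \<subseteq> {..<2 ^ (k - 1) - 1 :: nat} \<and>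
      (\<forall>c. acyclic (Restr (arcs_ends G) {x \<in> verts G. f x = c}))"
  proof (rule greedy_dicolouring[OF G(3-5)])
    fix v K and f :: "_ \<Rightarrow> nat"
    assume K: "v \<in> verts G" "K \<subseteq> verts G - {v}" "tournament_on (arcs_ends G) (insert v K)"
    have "finite K" "insert v K \<subseteq> verts G" "v \<notin> K" using K finite_subset[OF _ G(3)] by auto
    then have "\<exists>c<2 ^ (k - 1) - 1. c \<notin> f ` K"
      using K(3) no_TT subset_trans by (intro transitive_list_free_colour[of K v "arcs_ends G"]) blast+
    \<comment> \<open>A colour absent from \<open>K\<close> satisfies the triangle condition
      vacuously.\<close>
    then show "\<exists>c<2 ^ (k - 1) - 1. \<forall>a\<in>K. \<forall>b\<in>K. f a = c \<longrightarrow> f b = c \<longrightarrow>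
        (v, a) \<in> arcs_ends G \<longrightarrow> (a, b) \<in> arcs_ends G \<longrightarrow> (b, v) \<notin> arcs_ends G"
      by blast
  qed
  then show ?thesis using dichromatic_number_le[OF G(1,3)] by blast
qed

lemma dichromatic_number_Delta11_free:
  assumes "G \<in> chordal_orientations" "\<not> has_induced_copy (Delta11 k) G" "k \<ge> 1"
  shows "dichromatic_number G \<le> 2 ^ (2 * k - 2)"
proof -
  note G = chordal_orientationsD[OF assms(1)]
  have no_delta: "length ts \<noteq> k"
    if "delta_list (arcs_ends G) x y ts" "set (x # y # ts) \<subseteq> verts G" for x y ts
    using has_induced_copy_Delta11[OF G(2,4) that] assms(2) by auto
  have "\<exists>f. f ` verts G \<subseteq> {..<2 ^ (2 * k - 2) :: nat} \<and>
      (\<forall>c. acyclic (Restr (arcs_ends G) {x \<in> verts G. f x = c}))"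
  proof (rule greedy_dicolouring[OF G(3-5)])
    fix v K and f :: "_ \<Rightarrow> nat"
    assume K: "v \<in> verts G" "K \<subseteq> verts G - {v}" "tournament_on (arcs_ends G) (insert v K)"
    have "finite K" "insert v K \<subseteq> verts G" using K finite_subset[OF _ G(3)] by auto
    then show "\<exists>c<2 ^ (2 * k - 2). \<forall>a\<in>K. \<forall>b\<in>K. f a = c \<longrightarrow> f b = c \<longrightarrow>
        (v, a) \<in> arcs_ends G \<longrightarrow> (a, b) \<in> arcs_ends G \<longrightarrow> (b, v) \<notin> arcs_ends G"
      using K(3) G(4) assms(3) no_delta by (intro delta_list_free_colour) (blast dest: subset_trans)+
  qed
  then show ?thesis using dichromatic_number_le[OF G(1,3)] by blast
qed

theorem theorem2p5:
  fixes k :: nat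
  assumes "k \<ge> 1"
  shows "hero (TT k) (chordal_orientations :: ('a,'b) pre_digraph set) \<and>
    hero (Delta11 k) (chordal_orientations :: ('a,'b) pre_digraph set) \<and>
    (\<forall>G \<in> (chordal_orientations :: ('a,'b) pre_digraph set).
       \<not> has_induced_copy (TT k) G \<longrightarrow> dichromatic_number G \<le> 2 ^ (k - 1) - 1) \<and>
    (\<forall>G \<in> (chordal_orientations :: ('a,'b) pre_digraph set).
       \<not> has_induced_copy (Delta11 k) G \<longrightarrow> dichromatic_number G \<le> 2 ^ (2 * k - 2))"
proof (intro conjI)
  show TT: "\<forall>G \<in> (chordal_orientations :: ('a,'b) pre_digraph set).
      \<not> has_induced_copy (TT k) G \<longrightarrow> dichromatic_number G \<le> 2 ^ (k - 1) - 1"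
    by (intro ballI impI dichromatic_number_TT_free assms)
  show Delta11: "\<forall>G \<in> (chordal_orientations :: ('a,'b) pre_digraph set).
      \<not> has_induced_copy (Delta11 k) G \<longrightarrow> dichromatic_number G \<le> 2 ^ (2 * k - 2)"
    by (intro ballI impI dichromatic_number_Delta11_free assms)
  show "hero (TT k) (chordal_orientations :: ('a,'b) pre_digraph set)"
    unfolding hero_def using TT by (rule exI)
  show "hero (Delta11 k) (chordal_orientations :: ('a,'b) pre_digraph set)"
    unfolding hero_def using Delta11 by (rule exI)
qed

end
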